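(* Let $\Omega$ be a proper (i.e., both $\Omega$ and $\Omega^c$ are nonempty), closed, and convex subset of $\mathbb{R}^n$ with the Euclidean norm. Then the convex subdifferential of the signed distance function $\widehat d(\cdot;\Omega)$ at $\bar x\in\mathbb{R}^n$ is $$\partial\widehat d(\bar x;\Omega)=\begin{cases}\left\{\dfrac{\bar x-Q_{\Omega}(\bar x)}{\widehat d(\bar x;\Omega)}\right\}&\text{if }\bar x\in\Omega^c,\\[2ex]\left\{\dfrac{\bar x-\operatorname{co}Q_{\Omega}(\bar x)}{\widehat d(\bar x;\Omega)}\right\}&\text{if }\bar x\in\operatorname{int}(\Omega),\\[2ex]\operatorname{co}\big(\mathbb{S}\cap N(\bar x;\Omega)\big)&\text{if }\bar x\in\operatorname{bd}(\Omega),\end{cases}$$ where $\mathbb{S}$ is the unit sphere of $\mathbb{R}^n$, and where for a set $A\subset\mathbb{R}^n$ and a scalar $c\ne0$ the expression $\{(\bar x-A)/c\}$ means $\{(\bar x-a)/c\mid a\in A\}$.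
   Context: $\Omega^c=\mathbb{R}^n\setminus\Omega$; $\operatorname{co}$ denotes the convex hull. For nonempty $\Theta\subset\mathbb{R}^n$, $d(x;\Theta):=\inf\{\|w-x\|\mid w\in\Theta\}$ and $\Pi(x;\Theta):=\{w\in\Theta\mid\|x-w\|=d(x;\Theta)\}$. The signed distance function is $\widehat d(x;\Omega):=d(x;\Omega)$ if $x\in\Omega^c$ and $\widehat d(x;\Omega):=-d(x;\Omega^c)$ if $x\in\Omega$ (it is convex when $\Omega$ is convex). The set $Q_\Omega(x)$ is $\Pi(x;\overline{\Omega})$ if $x\in\Omega^c$ and $\Pi(x;\overline{\Omega^c})$ if $x\in\Omega$. The normal cone at $\bar x\in\Omega$ is $N(\bar x;\Omega):=\{v\in\mathbb{R}^n\mid\langle v,x-\bar x\rangle\le 0\text{ for all }x\in\Omega\}$. For convex $\varphi:\mathbb{R}^n\to\mathbb{R}$, $\partial\varphi(\bar x):=\{v\in\mathbb{R}^n\mid\langle v,x-\bar x\rangle\le\varphi(x)-\varphi(\bar x)\text{ for all }x\in\mathbb{R}^n\}$. *)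

theory Defs
  imports "HOL-Analysis.Analysis"
begin

text \<open>
  The distance function is the library's \<^const>\<open>infdist\<close>, which agrees with the infimum of the
  distances on nonempty sets (and is \<open>0\<close> by convention for the empty set).
\<close>

text \<open>The metric projection is set-valued, unlike the library's \<^const>\<open>closest_point\<close>,
  which selects a single minimiser.\<close>

definition metric_proj :: "'a::metric_space \<Rightarrow> 'a set \<Rightarrow> 'a set" where
  "metric_proj x \<Theta> = {w \<in> \<Theta>. dist x w = infdist x \<Theta>}"

definition signed_dist :: "'a::metric_space set \<Rightarrow> 'a \<Rightarrow> real" where
  "signed_dist \<Omega> x = (if x \<in> - \<Omega> then infdist x \<Omega> else - infdist x (- \<Omega>))"

definition Q_set :: "'a::metric_space set \<Rightarrow> 'a \<Rightarrow> 'a set" where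
  "Q_set \<Omega> x =
     (if x \<in> - \<Omega> then metric_proj x (closure \<Omega>) else metric_proj x (closure (- \<Omega>)))"

text \<open>Only meaningful for base points \<open>x \<in> \<Omega>\<close>.\<close>

definition normal_cone :: "'a::real_inner \<Rightarrow> 'a set \<Rightarrow> 'a set" where
  "normal_cone x \<Omega> = {v. \<forall>y\<in>\<Omega>. v \<bullet> (y - x) \<le> 0}"

definition subdifferential :: "('a::real_inner \<Rightarrow> real) \<Rightarrow> 'a \<Rightarrow> 'a set" where
  "subdifferential \<phi> x = {v. \<forall>y. v \<bullet> (y - x) \<le> \<phi> y - \<phi> x}"

end

theory Submission
  imports Defs
begin

text \<open>
  For a proper closed convex set \<open>\<Omega>\<close> with support function \<open>\<sigma>\<close>, the signed distance is
  the maximum of \<open>v \<bullet> x - \<sigma> v\<close> over unit vectors \<open>v\<close>. At each point \<open>x\<close> the subdifferential is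
  the convex hull of the set of maximisers, as for any maximum of affine functions: a subgradient
  outside this compact hull would be separated from it by a direction \<open>e\<close>, while limits of
  maximisers at \<open>x + t e\<close>, \<open>t \<rightarrow> 0\<close>, are maximisers at \<open>x\<close>. The three cases of the theorem arise by
  identifying the maximisers: on the boundary they are the unit normals, elsewhere they
  correspond to the projections of \<open>x\<close> onto \<open>\<Omega>\<close> or onto its complement.
\<close>

text \<open>The maximisers, described without mentioning the extended-real-valued support function.\<close>

definition active_normals :: "'a::real_inner set \<Rightarrow> 'a \<Rightarrow> 'a set" where
  "active_normals \<Omega> x = {v \<in> sphere 0 1. \<forall>y\<in>\<Omega>. v \<bullet> (y - x) \<le> - signed_dist \<Omega> x}"

section \<open>Auxiliary facts on unit vectors, inscribed balls and supporting hyperplanes\<close>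

lemma infdist_closure: "infdist x (closure S) = infdist x S"
  by (simp add: infdist_eq_setdist)

text \<open>Equality case of Cauchy-Schwarz: the chain
  \<open>r \<le> v \<bullet> w \<le> norm w \<le> r\<close> collapses.\<close>

lemma unit_vector_eqI:
  fixes v w :: "'a::real_inner"
  assumes "norm v = 1" and "norm w \<le> r" and "r \<le> v \<bullet> w"
  shows "w = r *\<^sub>R v"
proof -
  have "v \<bullet> w \<le> norm w"
    using norm_cauchy_schwarz[of v w] assms(1) by simp
  then have "norm w = r" "v \<bullet> w = norm v * norm w"
    using assms by auto
  then show ?thesis
    using assms(1) norm_cauchy_schwarz_eq[of v w] by simp
qed

text \<open>No point of the complement is closer than the radius, so the open ball lies in
  \<open>\<Omega>\<close>; closedness extends this to the closed ball. Radius zero is separate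
  because the open ball is then empty.\<close>

lemma cball_infdist_subset:
  fixes x :: "'a::real_normed_vector"
  assumes "closed \<Omega>" and "x \<in> \<Omega>"
  shows "cball x (infdist x (- \<Omega>)) \<subseteq> \<Omega>"
proof (cases "infdist x (- \<Omega>) = 0")
  case True
  then show ?thesis using assms by simp
next
  case False
  then have "infdist x (- \<Omega>) > 0"
    using infdist_nonneg[of x "- \<Omega>"] by linarith
  moreover have "ball x (infdist x (- \<Omega>)) \<subseteq> \<Omega>"
    using infdist_le[of _ "- \<Omega>" x] by force
  ultimately show ?thesis
    using assms(1) by (metis closure_ball closure_minimal)
qed

text \<open>With empty interior, \<open>S\<close> lies in a hyperplane whose normal serves with
  equality. Otherwise the interior is separated from \<open>a\<close>, and the inequality passes to
  the closure of \<open>S\<close>, which is the closure of its interior.\<close>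

lemma supporting_hyperplane_frontier:
  fixes S :: "'a::euclidean_space set"
  assumes "convex S" and "a \<in> frontier S"
  obtains w where "norm w = 1" and "\<And>y. y \<in> S \<Longrightarrow> w \<bullet> y \<le> w \<bullet> a"
proof -
  have aS: "a \<in> closure S" and ani: "a \<notin> interior S"
    using assms(2) by (auto simp: frontier_def)
  obtain c where c: "c \<noteq> 0" "\<And>y. y \<in> closure S \<Longrightarrow> c \<bullet> y \<le> c \<bullet> a"
  proof (cases "interior S = {}")
    case True
    obtain c b where c: "c \<noteq> 0" "S \<subseteq> {x. c \<bullet> x = b}"
      using empty_interior_subset_hyperplane[OF assms(1) True] by blast
    then have "closure S \<subseteq> {x. c \<bullet> x = b}"
      by (simp add: closed_hyperplane closure_minimal)
    then have eq: "c \<bullet> y = b" if "y \<in> closure S" for y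
      using that by blast
    show ?thesis
      by (rule that[OF c(1)]) (simp add: eq aS)
  next
    case False
    then obtain c b where c: "c \<noteq> 0" "\<forall>y\<in>interior S. c \<bullet> y \<le> b" "b \<le> c \<bullet> a"
      using separating_hyperplane_sets[of "interior S" "{a}"] ani assms(1)
      by (auto simp: convex_interior)
    then have "closure (interior S) \<subseteq> {y. c \<bullet> y \<le> b}"
      by (intro closure_minimal) (auto simp: closed_halfspace_le)
    then have "closure S \<subseteq> {y. c \<bullet> y \<le> b}"
      using convex_closure_interior[OF assms(1) False] by simp
    then have "c \<bullet> y \<le> c \<bullet> a" if "y \<in> closure S" for y
      using c(3) that by fastforce
    then show ?thesis by (rule that[OF c(1)])
  qed
  show ?thesis
  proof (rule that[of "c /\<^sub>R norm c"])
    show "norm (c /\<^sub>R norm c) = 1" using c(1) by simp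
    show "(c /\<^sub>R norm c) \<bullet> y \<le> (c /\<^sub>R norm c) \<bullet> a" if "y \<in> S" for y
      using c closure_subset[of S] that by (auto intro!: mult_left_mono)
  qed
qed

section \<open>Active normals and projections\<close>

lemma mem_active_normals:
  "v \<in> active_normals \<Omega> x \<longleftrightarrow>
     norm v = 1 \<and> (\<forall>y\<in>\<Omega>. v \<bullet> (y - x) \<le> - signed_dist \<Omega> x)"
  by (auto simp: active_normals_def)

lemma compact_active_normals:
  fixes \<Omega> :: "'a::euclidean_space set"
  shows "compact (active_normals \<Omega> x)"
proof -
  have "active_normals \<Omega> x =
      sphere 0 1 \<inter> (\<Inter>y\<in>\<Omega>. {v. (y - x) \<bullet> v \<le> - signed_dist \<Omega> x})"
    by (auto simp: active_normals_def inner_commute)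
  then show ?thesis
    by (simp add: compact_Int_closed closed_INT closed_halfspace_le)
qed

lemma active_normals_frontier:
  assumes "x \<in> frontier \<Omega>" and "closed \<Omega>"
  shows "active_normals \<Omega> x = sphere 0 1 \<inter> normal_cone x \<Omega>"
proof -
  have "x \<in> \<Omega>" and "x \<in> closure (- \<Omega>)"
    using assms frontier_subset_closed by (auto simp: frontier_closures)
  then have "signed_dist \<Omega> x = 0"
    by (metis ComplD closure_empty empty_iff in_closure_iff_infdist_zero neg_equal_0_iff_equal
        signed_dist_def)
  then show ?thesis
    by (auto simp: active_normals_def normal_cone_def)
qed

text \<open>The obtuse-angle property \<open>(x - a) \<bullet> (y - a) \<le> 0\<close> of a
  projection onto a closed convex set, shifted from \<open>a\<close> to \<open>x\<close> and divided
  by the distance.\<close>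

lemma projection_active_exterior:
  fixes \<Omega> :: "'a::euclidean_space set"
  assumes "closed \<Omega>" and "convex \<Omega>" and "x \<notin> \<Omega>" and "a \<in> Q_set \<Omega> x"
  shows "(x - a) /\<^sub>R signed_dist \<Omega> x \<in> active_normals \<Omega> x"
proof -
  define d where "d = signed_dist \<Omega> x"
  have d: "d = infdist x \<Omega>" and a: "a \<in> \<Omega>" "dist x a = d"
    using assms by (auto simp: d_def signed_dist_def Q_set_def metric_proj_def closure_closed)
  have "d > 0"
    using a assms(3) by (metis zero_less_dist_iff)
  have nd: "norm (x - a) = d"
    using a(2) by (simp add: dist_norm)
  have "(x - a) \<bullet> (y - x) \<le> - d * d" if "y \<in> \<Omega>" for y
  proof -
    have "(x - a) \<bullet> (y - a) \<le> 0"
      using any_closest_point_dot[OF assms(2,1) a(1) that, of x] a(2) d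
      by (simp add: infdist_le)
    moreover have "(x - a) \<bullet> (x - a) = d * d"
      using nd by (simp add: dot_square_norm power2_eq_square)
    ultimately show ?thesis
      by (simp add: inner_diff_right)
  qed
  then have "inverse d * ((x - a) \<bullet> (y - x)) \<le> inverse d * (- (d * d))" if "y \<in> \<Omega>" for y
    using \<open>d > 0\<close> that by (intro mult_left_mono) auto
  then have "((x - a) /\<^sub>R d) \<bullet> (y - x) \<le> - d" if "y \<in> \<Omega>" for y
    using \<open>d > 0\<close> that by (simp flip: mult.assoc)
  moreover have "norm ((x - a) /\<^sub>R d) = 1"
    using nd \<open>d > 0\<close> by simp
  ultimately show ?thesis
    by (simp add: mem_active_normals flip: d_def)
qed

text \<open>Testing the active inequality at \<open>a\<close> itself gives
  \<open>d \<le> v \<bullet> (x - a)\<close>; since \<open>norm (x - a) = d\<close>, equality holds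
  in Cauchy-Schwarz.\<close>

lemma active_exterior_unique:
  fixes \<Omega> :: "'a::euclidean_space set"
  assumes "closed \<Omega>" and "x \<notin> \<Omega>" and "a \<in> Q_set \<Omega> x" and "v \<in> active_normals \<Omega> x"
  shows "v = (x - a) /\<^sub>R signed_dist \<Omega> x"
proof -
  define d where "d = signed_dist \<Omega> x"
  have a: "a \<in> \<Omega>" "norm (x - a) = d"
    using assms
    by (auto simp: d_def signed_dist_def Q_set_def metric_proj_def closure_closed dist_norm)
  then have "d \<noteq> 0"
    using assms(2) by auto
  have v: "norm v = 1" "v \<bullet> (a - x) \<le> - d"
    using assms(4) a(1) by (auto simp: mem_active_normals d_def)
  have "d \<le> v \<bullet> (x - a)"
    using v(2) by (simp add: inner_diff_right)
  then have "x - a = d *\<^sub>R v"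
    using unit_vector_eqI[OF v(1)] a(2) by simp
  with \<open>d \<noteq> 0\<close> show ?thesis
    by (simp flip: d_def)
qed

text \<open>A nearest point of the closed complement is a frontier point, and the normal of a
  supporting hyperplane there is the desired vector. The conclusion is a product rather than a
  quotient because \<open>x\<close> may lie on the frontier, where the signed distance
  vanishes.\<close>

lemma projection_active_interior:
  fixes \<Omega> :: "'a::euclidean_space set"
  assumes "closed \<Omega>" and "convex \<Omega>" and "x \<in> \<Omega>" and "a \<in> Q_set \<Omega> x"
  obtains w where "w \<in> active_normals \<Omega> x" and "x - a = signed_dist \<Omega> x *\<^sub>R w"
proof -
  define r where "r = infdist x (- \<Omega>)"
  have sd: "signed_dist \<Omega> x = - r"
    using assms(3) by (simp add: signed_dist_def r_def)
  have a: "a \<in> closure (- \<Omega>)" "dist x a = r"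
    using assms(3,4) by (auto simp: Q_set_def metric_proj_def r_def infdist_closure)
  have sub: "cball x r \<subseteq> \<Omega>"
    using cball_infdist_subset[OF assms(1,3)] by (simp add: r_def)
  then have "a \<in> frontier \<Omega>"
    using a assms(1) by (auto simp: frontier_closures closure_closed)
  then obtain w where w: "norm w = 1" "\<And>y. y \<in> \<Omega> \<Longrightarrow> w \<bullet> y \<le> w \<bullet> a"
    using supporting_hyperplane_frontier[OF assms(2)] by blast
  have "r \<ge> 0" by (simp add: r_def infdist_nonneg)
  \<comment> \<open>The point of the inscribed ball farthest in direction \<open>w\<close> still
    lies below the hyperplane, which forces \<open>a\<close> to be that point.\<close>
  then have "x + r *\<^sub>R w \<in> cball x r"
    using w(1) by (simp add: dist_norm)
  with w(2) sub have "w \<bullet> (x + r *\<^sub>R w) \<le> w \<bullet> a" by blast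
  then have "r \<le> w \<bullet> (a - x)"
    using w(1) by (simp add: inner_diff_right inner_add_right dot_square_norm)
  moreover have "norm (a - x) \<le> r"
    using a(2) by (simp add: dist_norm norm_minus_commute)
  ultimately have ax: "a - x = r *\<^sub>R w"
    using unit_vector_eqI[OF w(1)] by blast
  then have "w \<bullet> a - w \<bullet> x = r"
    using w(1) by (simp add: dot_square_norm flip: inner_diff_right)
  then have "w \<in> active_normals \<Omega> x"
    using w by (auto simp: mem_active_normals sd inner_diff_right)
  moreover have "x - a = signed_dist \<Omega> x *\<^sub>R w"
    using ax sd by (metis minus_diff_eq scaleR_minus_left)
  ultimately show ?thesis by (rule that)
qed

text \<open>Moving from \<open>x\<close> by \<open>r\<close> along \<open>v\<close> uses up the
  bound \<open>r\<close> on \<open>v \<bullet> (y - x)\<close> over \<open>\<Omega>\<close>. Any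
  further step leaves \<open>\<Omega>\<close>, so the endpoint is a limit of outside points at the
  minimal distance.\<close>

lemma active_interior_projection:
  fixes \<Omega> :: "'a::euclidean_space set"
  assumes "x \<in> \<Omega>" and "closed \<Omega>" and "v \<in> active_normals \<Omega> x"
  shows "x - signed_dist \<Omega> x *\<^sub>R v \<in> Q_set \<Omega> x"
proof -
  define r where "r = infdist x (- \<Omega>)"
  have sd: "signed_dist \<Omega> x = - r"
    using assms(1) by (simp add: signed_dist_def r_def)
  have v: "norm v = 1" "\<And>y. y \<in> \<Omega> \<Longrightarrow> v \<bullet> (y - x) \<le> r"
    using assms(3) by (auto simp: mem_active_normals sd)
  define a where "a = x + r *\<^sub>R v"
  have "a + e *\<^sub>R v \<in> - \<Omega>" if "e > 0" for e
    using v that by (force simp: a_def inner_add_right dot_square_norm)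
  then have "\<exists>y\<in>- \<Omega>. dist y a < e" if "e > 0" for e
    using that v(1) by (intro bexI[of _ "a + (e/2) *\<^sub>R v"]) (auto simp: dist_norm)
  then have "a \<in> closure (- \<Omega>)"
    by (simp add: closure_approachable)
  moreover have "dist x a = r"
    using v(1) by (simp add: a_def dist_norm r_def infdist_nonneg)
  ultimately have "a \<in> Q_set \<Omega> x"
    using assms(1) by (simp add: Q_set_def metric_proj_def r_def infdist_closure)
  then show ?thesis by (simp add: a_def sd)
qed

lemma Q_set_nonempty:
  fixes \<Omega> :: "'a::heine_borel set"
  assumes "\<Omega> \<noteq> {}" and "- \<Omega> \<noteq> {}"
  shows "Q_set \<Omega> x \<noteq> {}"
proof -
  have "metric_proj x (closure S) \<noteq> {}" if "S \<noteq> {}" for S :: "'a set"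
  proof -
    have "closure S \<noteq> {}" using that by simp
    then obtain w where "w \<in> closure S" "infdist x (closure S) = dist x w"
      using infdist_attains_inf[OF closed_closure] by blast
    then have "w \<in> metric_proj x (closure S)" by (simp add: metric_proj_def)
    then show ?thesis by blast
  qed
  with assms show ?thesis by (simp add: Q_set_def)
qed

text \<open>The maximum of the affine functions is attained at every point: any projection yields a
  maximiser.\<close>

lemma active_normals_nonempty:
  fixes \<Omega> :: "'a::euclidean_space set"
  assumes "\<Omega> \<noteq> {}" and "- \<Omega> \<noteq> {}" and "closed \<Omega>" and "convex \<Omega>"
  shows "active_normals \<Omega> x \<noteq> {}"
proof -
  obtain a where "a \<in> Q_set \<Omega> x"
    using Q_set_nonempty[OF assms(1,2)] by blast
  then show ?thesis
    using projection_active_exterior[OF assms(3,4)] projection_active_interior[OF assms(3,4)]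
    by (cases "x \<in> \<Omega>") blast+
qed

section \<open>The subdifferential as the convex hull of the active normals\<close>

lemma convex_subdifferential: "convex (subdifferential \<phi> x)"
proof -
  have "subdifferential \<phi> x = (\<Inter>y. {v. (y - x) \<bullet> v \<le> \<phi> y - \<phi> x})"
    by (auto simp: subdifferential_def inner_commute)
  then show ?thesis
    by (simp add: convex_INT convex_halfspace_le)
qed

lemma active_normals_subset_subdifferential:
  fixes \<Omega> :: "'a::euclidean_space set"
  assumes "\<Omega> \<noteq> {}" and "closed \<Omega>"
  shows "active_normals \<Omega> x \<subseteq> subdifferential (signed_dist \<Omega>) x"
proof
  fix v assume "v \<in> active_normals \<Omega> x"
  then have v: "norm v = 1" "\<And>z. z \<in> \<Omega> \<Longrightarrow> v \<bullet> (z - x) \<le> - signed_dist \<Omega> x"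
    by (auto simp: mem_active_normals)
  have "v \<bullet> (y - x) \<le> signed_dist \<Omega> y - signed_dist \<Omega> x" for y
  proof (cases "y \<in> \<Omega>")
    case True
    define r where "r = infdist y (- \<Omega>)"
    \<comment> \<open>Pushing \<open>y\<close> along \<open>v\<close> by its distance to the
      complement stays in \<open>\<Omega>\<close> and gains exactly \<open>r\<close> in the active
      inequality.\<close>
    have "y + r *\<^sub>R v \<in> cball y r"
      using v(1) by (simp add: dist_norm r_def infdist_nonneg)
    then have "y + r *\<^sub>R v \<in> \<Omega>"
      using cball_infdist_subset[OF assms(2) True] by (auto simp: r_def)
    then have "v \<bullet> (y + r *\<^sub>R v - x) \<le> - signed_dist \<Omega> x" by (rule v(2))
    then have "v \<bullet> (y - x) + r \<le> - signed_dist \<Omega> x"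
      using v(1) by (simp add: inner_diff_right inner_add_right dot_square_norm)
    moreover have "signed_dist \<Omega> y = - r"
      using True by (simp add: signed_dist_def r_def)
    ultimately show ?thesis by simp
  next
    case False
    \<comment> \<open>Outside \<open>\<Omega>\<close>, the active inequality is applied at a
      projection \<open>p\<close>; the remainder \<open>v \<bullet> (y - p)\<close> is at most the
      distance.\<close>
    obtain p where p: "p \<in> \<Omega>" "infdist y \<Omega> = dist y p"
      using infdist_attains_inf[OF assms(2,1)] by blast
    have "v \<bullet> (y - p) \<le> dist y p"
      using norm_cauchy_schwarz[of v "y - p"] v(1) by (simp add: dist_norm)
    moreover have "signed_dist \<Omega> y = dist y p"
      using False p by (simp add: signed_dist_def)
    ultimately show ?thesis
      using v(2)[OF p(1)] by (simp add: inner_diff_right)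
  qed
  then show "v \<in> subdifferential (signed_dist \<Omega>) x"
    by (simp add: subdifferential_def)
qed

text \<open>Active normals at points approaching \<open>x\<close> along \<open>e\<close> dominate
  \<open>u\<close> in direction \<open>e\<close> by monotonicity of subgradients; a limit of them on
  the compact sphere is active at \<open>x\<close>.\<close>

lemma subdifferential_directional_le:
  fixes \<Omega> :: "'a::euclidean_space set"
  assumes "\<Omega> \<noteq> {}" and "- \<Omega> \<noteq> {}" and "closed \<Omega>" and "convex \<Omega>"
    and u: "u \<in> subdifferential (signed_dist \<Omega>) x"
  obtains v where "v \<in> active_normals \<Omega> x" and "u \<bullet> e \<le> v \<bullet> e"
proof -
  define t where "t k = inverse (real (Suc k))" for k
  have t: "t k > 0" for k by (simp add: t_def)
  have t0: "t \<longlonglongrightarrow> 0"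
    unfolding t_def by (rule LIMSEQ_inverse_real_of_nat)
  define y where "y k = x + t k *\<^sub>R e" for k
  have "\<forall>k. \<exists>v. v \<in> active_normals \<Omega> (y k)"
    using active_normals_nonempty[OF assms(1-4)] by blast
  then obtain f where f: "\<And>k. f k \<in> active_normals \<Omega> (y k)" by metis
  have lower: "t k * (u \<bullet> e) \<le> signed_dist \<Omega> (y k) - signed_dist \<Omega> x" for k
  proof -
    have "u \<bullet> (y k - x) \<le> signed_dist \<Omega> (y k) - signed_dist \<Omega> x"
      using u by (simp add: subdifferential_def)
    then show ?thesis by (simp add: y_def)
  qed
  have "f k \<in> subdifferential (signed_dist \<Omega>) (y k)" for k
    using active_normals_subset_subdifferential[OF assms(1,3)] f by blast
  \<comment> \<open>The subgradient at \<open>y k\<close> is tested back at \<open>x\<close>,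
    bounding from above the same increment that \<open>lower\<close> bounds from below.\<close>
  then have "f k \<bullet> (x - y k) \<le> signed_dist \<Omega> x - signed_dist \<Omega> (y k)" for k
    by (simp add: subdifferential_def)
  then have upper: "signed_dist \<Omega> (y k) - signed_dist \<Omega> x \<le> t k * (f k \<bullet> e)" for k
    by (simp add: y_def algebra_simps)
  have mono: "u \<bullet> e \<le> f k \<bullet> e" for k
    using order_trans[OF lower upper, of k] t[of k] by simp
  have "f k \<in> sphere 0 1" for k
    using f by (simp add: mem_active_normals)
  then obtain v s where v: "v \<in> sphere 0 1" "strict_mono (s :: nat \<Rightarrow> nat)" "(f \<circ> s) \<longlonglongrightarrow> v"
    using seq_compactE[of "sphere 0 1" f] compact_sphere[of 0 1] compact_eq_seq_compact_metric
    by metis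
  have ts: "(\<lambda>k. t (s k)) \<longlonglongrightarrow> 0"
    using LIMSEQ_subseq_LIMSEQ[OF t0 v(2)] by (simp add: o_def)
  have fs: "(\<lambda>k. f (s k)) \<longlonglongrightarrow> v"
    using v(3) by (simp add: o_def)
  have "u \<bullet> e \<le> v \<bullet> e"
  proof (rule LIMSEQ_le_const)
    show "(\<lambda>k. f (s k) \<bullet> e) \<longlonglongrightarrow> v \<bullet> e" by (intro tendsto_intros fs)
  qed (use mono in auto)
  moreover have "v \<bullet> (z - x) \<le> - signed_dist \<Omega> x" if "z \<in> \<Omega>" for z
  proof (rule LIMSEQ_le)
    have "(\<lambda>k. f (s k) \<bullet> (z - (x + t (s k) *\<^sub>R e))) \<longlonglongrightarrow> v \<bullet> (z - (x + 0 *\<^sub>R e))"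
      by (intro tendsto_intros fs ts)
    then show "(\<lambda>k. f (s k) \<bullet> (z - y (s k))) \<longlonglongrightarrow> v \<bullet> (z - x)"
      by (simp add: y_def)
    have "(\<lambda>k. - signed_dist \<Omega> x - t (s k) * (u \<bullet> e)) \<longlonglongrightarrow> - signed_dist \<Omega> x - 0 * (u \<bullet> e)"
      by (intro tendsto_intros ts)
    then show "(\<lambda>k. - signed_dist \<Omega> x - t (s k) * (u \<bullet> e)) \<longlonglongrightarrow> - signed_dist \<Omega> x"
      by simp
    \<comment> \<open>The bound \<open>lower\<close> takes the place of continuity of the signed
      distance: it replaces the value at \<open>y k\<close> by the value at \<open>x\<close> up to a
      vanishing term.\<close>
    have "f k \<bullet> (z - y k) \<le> - signed_dist \<Omega> (y k)" for k
      using f that by (auto simp: mem_active_normals)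
    then have "f k \<bullet> (z - y k) \<le> - signed_dist \<Omega> x - t k * (u \<bullet> e)" for k
      using lower[of k] by (smt (verit))
    then show "\<exists>N. \<forall>k\<ge>N. f (s k) \<bullet> (z - y (s k)) \<le> - signed_dist \<Omega> x - t (s k) * (u \<bullet> e)"
      by blast
  qed
  then have "v \<in> active_normals \<Omega> x"
    using v(1) by (simp add: mem_active_normals)
  ultimately show ?thesis using that by blast
qed

theorem subdifferential_signed_dist:
  fixes \<Omega> :: "'a::euclidean_space set"
  assumes "\<Omega> \<noteq> {}" and "- \<Omega> \<noteq> {}" and "closed \<Omega>" and "convex \<Omega>"
  shows "subdifferential (signed_dist \<Omega>) x = convex hull (active_normals \<Omega> x)"
proof
  show "convex hull (active_normals \<Omega> x) \<subseteq> subdifferential (signed_dist \<Omega>) x"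
    by (intro hull_minimal active_normals_subset_subdifferential convex_subdifferential assms)
  show "subdifferential (signed_dist \<Omega>) x \<subseteq> convex hull (active_normals \<Omega> x)"
  proof
    fix u assume u: "u \<in> subdifferential (signed_dist \<Omega>) x"
    show "u \<in> convex hull (active_normals \<Omega> x)"
    proof (rule ccontr)
      assume "u \<notin> convex hull (active_normals \<Omega> x)"
      moreover have "closed (convex hull (active_normals \<Omega> x))"
        by (intro compact_imp_closed compact_convex_hull compact_active_normals)
      ultimately obtain c b where c: "c \<bullet> u < b" "\<And>v. v \<in> convex hull (active_normals \<Omega> x) \<Longrightarrow> b < c \<bullet> v"
        using separating_hyperplane_closed_point[OF convex_convex_hull] by metis
      \<comment> \<open>The direction is \<open>- c\<close> since \<open>u\<close> lies on the lower
        side of the separating hyperplane.\<close>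
      obtain v where "v \<in> active_normals \<Omega> x" "u \<bullet> (- c) \<le> v \<bullet> (- c)"
        using subdifferential_directional_le[OF assms u] by blast
      with c(1) c(2)[OF hull_inc, of v] show False
        by (simp add: inner_commute)
    qed
  qed
qed

section \<open>The three cases: exterior, interior and boundary\<close>

theorem theorem6p3:
  fixes \<Omega> :: "(real ^ 'n) set" and x :: "real ^ 'n"
  assumes "\<Omega> \<noteq> {}" and "- \<Omega> \<noteq> {}" and "closed \<Omega>" and "convex \<Omega>"
  shows
    "(x \<in> - \<Omega> \<longrightarrow>
        subdifferential (signed_dist \<Omega>) x =
          {(x - a) /\<^sub>R signed_dist \<Omega> x | a. a \<in> Q_set \<Omega> x}) \<and>
     (x \<in> interior \<Omega> \<longrightarrow>
        subdifferential (signed_dist \<Omega>) x =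
          {(x - a) /\<^sub>R signed_dist \<Omega> x | a. a \<in> convex hull (Q_set \<Omega> x)}) \<and>
     (x \<in> frontier \<Omega> \<longrightarrow>
        subdifferential (signed_dist \<Omega>) x =
          convex hull (sphere 0 1 \<inter> normal_cone x \<Omega>))"
proof (intro conjI impI)
  note main = subdifferential_signed_dist[OF assms, of x]
  define d where "d = signed_dist \<Omega> x"
  show "subdifferential (signed_dist \<Omega>) x = {(x - a) /\<^sub>R signed_dist \<Omega> x | a. a \<in> Q_set \<Omega> x}"
    if "x \<in> - \<Omega>"
  proof -
    have x: "x \<notin> \<Omega>" using that by simp
    obtain a where a: "a \<in> Q_set \<Omega> x"
      using Q_set_nonempty[OF assms(1,2)] by blast
    \<comment> \<open>Each projection gives the sole active normal, so all projections give the same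
      quotient and the convex hull is that single point.\<close>
    have act: "active_normals \<Omega> x = {(x - b) /\<^sub>R d}" if "b \<in> Q_set \<Omega> x" for b
      using projection_active_exterior[OF assms(3,4) x that]
        active_exterior_unique[OF assms(3) x that] unfolding d_def by blast
    have "(x - b) /\<^sub>R d = (x - a) /\<^sub>R d" if "b \<in> Q_set \<Omega> x" for b
      using act[OF that] act[OF a] by (metis singleton_inject)
    then have "{(x - b) /\<^sub>R d | b. b \<in> Q_set \<Omega> x} = {(x - a) /\<^sub>R d}"
      using a by blast
    then show ?thesis
      using main act[OF a] by (simp add: d_def)
  qed
  show "subdifferential (signed_dist \<Omega>) x =
      {(x - a) /\<^sub>R signed_dist \<Omega> x | a. a \<in> convex hull (Q_set \<Omega> x)}"
    if "x \<in> interior \<Omega>"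
  proof -
    have x: "x \<in> \<Omega>" using that interior_subset by blast
    \<comment> \<open>Interiority makes the distance to the complement positive, so dividing by
      \<open>d\<close> is legitimate.\<close>
    have "x \<notin> closure (- \<Omega>)"
      using that by (simp add: closure_complement)
    then have d: "d \<noteq> 0"
      using x in_closure_iff_infdist_zero[OF assms(2)] by (simp add: d_def signed_dist_def)
    \<comment> \<open>The quotient is written as an affine map so that taking convex hulls commutes
      with it.\<close>
    define g where "g a = x /\<^sub>R d + (- inverse d) *\<^sub>R a" for a
    have g: "g a = (x - a) /\<^sub>R d" for a
      by (simp add: g_def algebra_simps)
    have "active_normals \<Omega> x = g ` Q_set \<Omega> x"
    proof
      show "g ` Q_set \<Omega> x \<subseteq> active_normals \<Omega> x"
      proof clarify
        fix a assume "a \<in> Q_set \<Omega> x"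
        then obtain w where "w \<in> active_normals \<Omega> x" "x - a = d *\<^sub>R w"
          using projection_active_interior[OF assms(3,4) x] unfolding d_def by blast
        with d show "g a \<in> active_normals \<Omega> x" by (simp add: g)
      qed
      show "active_normals \<Omega> x \<subseteq> g ` Q_set \<Omega> x"
      proof
        fix v assume "v \<in> active_normals \<Omega> x"
        then have "x - d *\<^sub>R v \<in> Q_set \<Omega> x"
          using active_interior_projection[OF x assms(3)] by (simp add: d_def)
        moreover have "v = g (x - d *\<^sub>R v)" using d by (simp add: g)
        ultimately show "v \<in> g ` Q_set \<Omega> x" by blast
      qed
    qed
    moreover have "convex hull (g ` Q_set \<Omega> x) = g ` (convex hull (Q_set \<Omega> x))"
      unfolding g_def by (rule convex_hull_affinity)
    ultimately show ?thesis
      using main by (auto simp: g d_def)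
  qed
  show "subdifferential (signed_dist \<Omega>) x = convex hull (sphere 0 1 \<inter> normal_cone x \<Omega>)"
    if "x \<in> frontier \<Omega>"
    using main active_normals_frontier[OF that assms(3)] by simp
qed

end
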